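(* (1) The word $w_1=bbaaccabc$ in the free group $F_3=\langle a,b,c\rangle$ is polygonal with respect to the free basis $\{a,b,c\}$. (2) The word $w_2=aabbacbccadbdcdd$ in the free group $F_4=\langle a,b,c,d\rangle$ is polygonal with respect to the free basis $\{a,b,c,d\}$.
   Context: **Polygonal words.** Let $F$ be a finitely generated non-abelian free group with free basis $T$. Let $R_T$ be the bouquet of circles (the quotient of the Cayley graph of $F$ by $F$), one oriented circle labeled by each element of $T$, so $\pi_1(R_T)=F$. An immersion is a locally injective graph map. A loop in $R_T$ reads a cyclically reduced word if it is an immersed loop spelling that word. A polygonal disk $P$ is a closed 2-disk with a CW-structure such that $\partial P=P^{(1)}$ is a polygon. A side-pairing $\sim$ on polygonal disks $P_1,\dots,P_m$ is a partition of the set of all edges of the $\partial P_i$ into unordered pairs together with a homeomorphism between the two edges of each pair, where such a homeomorphism is not allowed to identify two consecutive edges of some $\partial P_i$ in a way that fixes a common vertex of the two edges. It determines a closed surface $S=\coprod_i P_i/\!\sim$, with its induced CW-structure; write $m(S)=m$. For a cyclically reduced word $w$ in $T\cup T^{-1}$, a $w$-polygonal surface is such an $S$ together with an immersion $\phi\colon S^{(1)}\to R_T$ such that each composition $\partial P_i\to S^{(1)}\to R_T$ reads a non-trivial power of $w$. The word $w$ is polygonal (with respect to $T$) if either $w$ is a proper power or there is a $w$-polygonal surface $S$ with $\chi(S)<m(S)$. *)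

theory Defs
  imports Main
begin

section \<open>Words in a free basis and its inverses\<close>

text \<open>The free basis \<open>T\<close> is the type \<open>'a\<close>. The letter \<open>(x, True)\<close> stands for \<open>x\<close> and
  \<open>(x, False)\<close> for its inverse. Elements of the free group on \<open>T\<close> are words modulo \<open>free_eq\<close>.\<close>

type_synonym 'a letter = "'a \<times> bool"
type_synonym 'a word = "'a letter list"

definition inv_letter :: "'a letter \<Rightarrow> 'a letter" where
  "inv_letter l = (fst l, \<not> snd l)"

definition inv_word :: "'a word \<Rightarrow> 'a word" where
  "inv_word w = rev (map inv_letter w)"

definition word_power :: "'a word \<Rightarrow> int \<Rightarrow> 'a word" where
  "word_power w k =
     (if k \<ge> 0 then concat (replicate (nat k) w) else concat (replicate (nat (- k)) (inv_word w)))"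

definition positive_word :: "'a list \<Rightarrow> 'a word" where
  "positive_word xs = map (\<lambda>x. (x, True)) xs"

inductive free_eq :: "'a word \<Rightarrow> 'a word \<Rightarrow> bool" where
  refl: "free_eq u u"
| sym: "free_eq u v \<Longrightarrow> free_eq v u"
| trans: "free_eq u v \<Longrightarrow> free_eq v w \<Longrightarrow> free_eq u w"
| cancel: "free_eq (u @ [l, inv_letter l] @ v) (u @ v)"

definition proper_power :: "'a word \<Rightarrow> bool" where
  "proper_power w \<longleftrightarrow> (\<exists>u n. n \<ge> 2 \<and> free_eq w (word_power u n))"

definition cyclically_reduced :: "'a word \<Rightarrow> bool" where
  "cyclically_reduced w \<longleftrightarrow> (\<forall>i < length w. w ! (Suc i mod length w) \<noteq> inv_letter (w ! i))"


section \<open>Graphs, graph maps, immersions\<close>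

text \<open>Graphs in the sense of Serre: every geometric edge gives two mutually reverse darts
  (oriented edges).\<close>

record ('v, 'd) dgraph =
  verts :: "'v set"
  darts :: "'d set"
  orig :: "'d \<Rightarrow> 'v"
  flip :: "'d \<Rightarrow> 'd"

definition edges :: "('v, 'd) dgraph \<Rightarrow> 'd set set" where
  "edges G = {{d, flip G d} | d. d \<in> darts G}"

definition graph_map ::
  "('v, 'd) dgraph \<Rightarrow> ('w, 'e) dgraph \<Rightarrow> ('v \<Rightarrow> 'w) \<Rightarrow> ('d \<Rightarrow> 'e) \<Rightarrow> bool" where
  "graph_map G H fv fd \<longleftrightarrow>
     (\<forall>v \<in> verts G. fv v \<in> verts H) \<and>
     (\<forall>d \<in> darts G. fd d \<in> darts H \<and> orig H (fd d) = fv (orig G d) \<and> fd (flip G d) = flip H (fd d))"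

definition immersion ::
  "('v, 'd) dgraph \<Rightarrow> ('w, 'e) dgraph \<Rightarrow> ('v \<Rightarrow> 'w) \<Rightarrow> ('d \<Rightarrow> 'e) \<Rightarrow> bool" where
  "immersion G H fv fd \<longleftrightarrow>
     graph_map G H fv fd \<and> (\<forall>v \<in> verts G. inj_on fd {d \<in> darts G. orig G d = v})"

text \<open>A loop is given by the cyclic sequence of darts it traverses.\<close>

definition immersed_loop :: "('v, 'd) dgraph \<Rightarrow> 'd list \<Rightarrow> bool" where
  "immersed_loop G p \<longleftrightarrow> p \<noteq> [] \<and> set p \<subseteq> darts G \<and>
     (\<forall>i < length p. orig G (p ! (Suc i mod length p)) = orig G (flip G (p ! i)) \<and>
                     p ! (Suc i mod length p) \<noteq> flip G (p ! i))"

definition bouquet :: "(unit, 'a letter) dgraph" where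
  "bouquet = \<lparr>verts = {()}, darts = UNIV, orig = (\<lambda>_. ()), flip = inv_letter\<rparr>"

text \<open>Loops have no preferred base point, hence the rotation.\<close>

definition reads :: "'a letter list \<Rightarrow> 'a word \<Rightarrow> bool" where
  "reads p u \<longleftrightarrow> immersed_loop bouquet p \<and> (\<exists>r. rotate r p = u)"


section \<open>Side-pairings and the closed surfaces they determine\<close>

text \<open>A family of \<open>m\<close> polygonal disks is given by the list \<open>ns\<close>, of length \<open>m\<close>, of their numbers of
  sides. The pair \<open>(i, j)\<close> with \<open>j < ns ! i\<close> denotes the \<open>j\<close>-th corner of the \<open>i\<close>-th disk, and also
  its \<open>j\<close>-th side, which joins corner \<open>j\<close> to corner \<open>j + 1\<close> (cyclically). A dart of a polygon is
  a side with a direction, \<open>True\<close> being the direction from corner \<open>j\<close> to corner \<open>j + 1\<close>.\<close>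

type_synonym corner = "nat \<times> nat"
type_synonym side = "nat \<times> nat"
type_synonym pdart = "side \<times> bool"

definition corners :: "nat list \<Rightarrow> corner set" where
  "corners ns = {(i, j). i < length ns \<and> j < ns ! i}"

definition next_corner :: "nat list \<Rightarrow> corner \<Rightarrow> corner" where
  "next_corner ns c = (fst c, Suc (snd c) mod (ns ! fst c))"

definition polygon_darts :: "nat list \<Rightarrow> pdart set" where
  "polygon_darts ns = corners ns \<times> UNIV"

definition porig :: "nat list \<Rightarrow> pdart \<Rightarrow> corner" where
  "porig ns d = (if snd d then fst d else next_corner ns (fst d))"

definition pflip :: "pdart \<Rightarrow> pdart" where
  "pflip d = (fst d, \<not> snd d)"

text \<open>A side-pairing is recorded by its effect \<open>\<sigma>\<close> on directed sides: \<open>d\<close> is glued to \<open>\<sigma> d\<close>,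
  origin to origin. This encodes both the partition of the sides into pairs and the
  homeomorphisms up to isotopy, which is all that the CW-structure of the quotient depends on.
  The last condition excludes folding two consecutive sides around a common corner.\<close>

definition side_pairing :: "nat list \<Rightarrow> (pdart \<Rightarrow> pdart) \<Rightarrow> bool" where
  "side_pairing ns \<sigma> \<longleftrightarrow>
     (\<forall>d \<in> polygon_darts ns.
        \<sigma> d \<in> polygon_darts ns \<and> \<sigma> (\<sigma> d) = d \<and> \<sigma> (pflip d) = pflip (\<sigma> d) \<and>
        fst (\<sigma> d) \<noteq> fst d \<and> porig ns (\<sigma> d) \<noteq> porig ns d)"

definition corner_eq :: "nat list \<Rightarrow> (pdart \<Rightarrow> pdart) \<Rightarrow> (corner \<times> corner) set" where
  "corner_eq ns \<sigma> = {(porig ns d, porig ns (\<sigma> d)) | d. d \<in> polygon_darts ns}\<^sup>*"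

text \<open>The 1-skeleton of the quotient surface: its vertices are the classes of corners, and its
  darts the classes \<open>{d, \<sigma> d}\<close>. For a class \<open>D\<close> of darts, the image of the origins of its members
  under \<open>corner_eq\<close> is a single class of corners.\<close>

definition skeleton :: "nat list \<Rightarrow> (pdart \<Rightarrow> pdart) \<Rightarrow> (corner set, pdart set) dgraph" where
  "skeleton ns \<sigma> =
     \<lparr>verts = corners ns // corner_eq ns \<sigma>,
      darts = {{d, \<sigma> d} | d. d \<in> polygon_darts ns},
      orig = (\<lambda>D. corner_eq ns \<sigma> `` (porig ns ` D)),
      flip = (\<lambda>D. pflip ` D)\<rparr>"

definition euler_char :: "nat list \<Rightarrow> (pdart \<Rightarrow> pdart) \<Rightarrow> int" where
  "euler_char ns \<sigma> =
     int (card (verts (skeleton ns \<sigma>))) - int (card (edges (skeleton ns \<sigma>))) + int (length ns)"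

definition boundary_loop :: "nat list \<Rightarrow> (pdart \<Rightarrow> pdart) \<Rightarrow> nat \<Rightarrow> pdart set list" where
  "boundary_loop ns \<sigma> i = map (\<lambda>j. {((i, j), True), \<sigma> ((i, j), True)}) [0..<ns ! i]"


section \<open>Polygonal words\<close>

definition polygonal_surface ::
  "'a word \<Rightarrow> nat list \<Rightarrow> (pdart \<Rightarrow> pdart) \<Rightarrow> (corner set \<Rightarrow> unit) \<Rightarrow> (pdart set \<Rightarrow> 'a letter) \<Rightarrow> bool" where
  "polygonal_surface w ns \<sigma> \<phi>v \<phi>d \<longleftrightarrow>
     (\<forall>n \<in> set ns. n \<ge> 1) \<and>
     side_pairing ns \<sigma> \<and>
     immersion (skeleton ns \<sigma>) bouquet \<phi>v \<phi>d \<and>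
     (\<forall>i < length ns. \<exists>k. k \<noteq> 0 \<and> reads (map \<phi>d (boundary_loop ns \<sigma> i)) (word_power w k))"

definition polygonal :: "'a word \<Rightarrow> bool" where
  "polygonal w \<longleftrightarrow> cyclically_reduced w \<and>
     (proper_power w \<or>
      (\<exists>ns \<sigma> \<phi>v \<phi>d. polygonal_surface w ns \<sigma> \<phi>v \<phi>d \<and> euler_char ns \<sigma> < int (length ns)))"


section \<open>The free bases of rank three and four\<close>

datatype basis3 = a3 | b3 | c3

datatype basis4 = a4 | b4 | c4 | d4

end

theory Submission
  imports Defs
begin

text \<open>Every vertex of the 1-skeleton has degree at least two, so the average degree \<open>2E/V\<close> exceeds
  two, that is \<open>\<chi>(S) < m(S)\<close>, as soon as some vertex has degree at least three. For both words a
  single disk suffices: an 18-gon reading \<open>w\<^sub>1\<^sup>2\<close> and a 16-gon reading \<open>w\<^sub>2\<close>. All sides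
  are glued by direction-preserving maps. The pairings were found by computer search; that
  the map to the bouquet is an immersion is certified by a labelling of the corners that is
  constant on vertices and separates equally labelled darts.\<close>

section \<open>Positive words\<close>

lemma positive_word_nth_neq_inv:
  assumes "i < length xs" "j < length xs"
  shows "positive_word xs ! i \<noteq> inv_letter (positive_word xs ! j)"
  using assms by (simp add: positive_word_def inv_letter_def)

lemma length_positive_word [simp]: "length (positive_word xs) = length xs"
  by (simp add: positive_word_def)

lemma cyclically_reduced_positive: "cyclically_reduced (positive_word xs)"
  unfolding cyclically_reduced_def
proof (intro allI impI)
  fix i
  assume "i < length (positive_word xs)"
  then show "positive_word xs ! (Suc i mod length (positive_word xs)) \<noteq>
      inv_letter (positive_word xs ! i)"
    by (intro positive_word_nth_neq_inv) (auto intro!: mod_less_divisor)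
qed

lemma reads_positive:
  assumes "xs \<noteq> []"
  shows "reads (positive_word xs) (positive_word xs)"
proof -
  have "immersed_loop bouquet (positive_word xs)"
    using assms cyclically_reduced_positive[of xs]
    by (simp add: immersed_loop_def bouquet_def cyclically_reduced_def)
      (simp add: positive_word_def)
  then show ?thesis
    unfolding reads_def by (metis rotate0 id_apply)
qed

lemma word_power_positive:
  "word_power (positive_word xs) (int k) = positive_word (concat (replicate k xs))"
  by (simp add: word_power_def positive_word_def map_concat)


section \<open>Direction-preserving side-pairings\<close>

lemma finite_corners: "finite (corners ns)"
proof -
  have "corners ns = (SIGMA i:{..<length ns}. {..<ns ! i})"
    by (auto simp: corners_def)
  then show ?thesis by simp
qed

lemma next_corner_in_corners: "s \<in> corners ns \<Longrightarrow> next_corner ns s \<in> corners ns"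
  by (auto simp: corners_def next_corner_def)

lemma inj_on_next_corner: "inj_on (next_corner ns) (corners ns)"
proof (rule inj_onI)
  fix s t
  assume "s \<in> corners ns" "t \<in> corners ns" "next_corner ns s = next_corner ns t"
  then show "s = t"
    by (cases s; cases t) (auto simp: corners_def next_corner_def mod_Suc split: if_splits)
qed

definition parallel_gluing :: "(side \<Rightarrow> side) \<Rightarrow> pdart \<Rightarrow> pdart" where
  "parallel_gluing \<pi> d = (\<pi> (fst d), snd d)"

text \<open>\<open>the_elem\<close> is meaningful when all members of \<open>D\<close> agree in
  label and direction, as they do for a class \<open>{d, \<sigma> d}\<close> once \<open>lab\<close>
  is constant on pairs.\<close>

definition dart_label :: "(side \<Rightarrow> 'a) \<Rightarrow> pdart set \<Rightarrow> 'a letter" where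
  "dart_label lab D = the_elem ((\<lambda>d. (lab (fst d), snd d)) ` D)"

text \<open>\<open>cls\<close> is a gluing-invariant label that stands in for the vertex containing
  a corner, so classes of corners never have to be computed. \<open>separated\<close> is local
  injectivity in disguise: backward darts originate at the end of their side, whence the alternative
  about \<open>next_corner\<close>.\<close>

locale labelled_pairing =
  fixes ns :: "nat list"
    and \<pi> :: "side \<Rightarrow> side"
    and lab :: "side \<Rightarrow> 'a"
    and cls :: "corner \<Rightarrow> 'c"
  assumes pair_in: "s \<in> corners ns \<Longrightarrow> \<pi> s \<in> corners ns"
    and pair_pair: "s \<in> corners ns \<Longrightarrow> \<pi> (\<pi> s) = s"
    and pair_neq: "s \<in> corners ns \<Longrightarrow> \<pi> s \<noteq> s"
    and lab_pair: "s \<in> corners ns \<Longrightarrow> lab (\<pi> s) = lab s"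
    and cls_pair: "s \<in> corners ns \<Longrightarrow> cls (\<pi> s) = cls s"
    and cls_next: "s \<in> corners ns \<Longrightarrow> cls (next_corner ns (\<pi> s)) = cls (next_corner ns s)"
    and separated: "s \<in> corners ns \<Longrightarrow> t \<in> corners ns \<Longrightarrow> lab s = lab t \<Longrightarrow>
      cls s = cls t \<or> cls (next_corner ns s) = cls (next_corner ns t) \<Longrightarrow> t = s \<or> t = \<pi> s"
begin

section \<open>The side-pairing and its immersion into the bouquet\<close>

abbreviation \<sigma> :: "pdart \<Rightarrow> pdart" where "\<sigma> \<equiv> parallel_gluing \<pi>"

text \<open>No two consecutive sides are folded: forward darts of a pair start at the distinct
  corners naming their sides, and for backward darts injectivity of \<open>next_corner\<close>
  separates the origins.\<close>

lemma side_pairing: "side_pairing ns \<sigma>"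
  using pair_in pair_pair pair_neq
    inj_on_next_corner[THEN inj_on_contraD, OF pair_neq pair_in]
  by (auto simp: side_pairing_def polygon_darts_def parallel_gluing_def pflip_def porig_def)

lemma cls_porig:
  assumes "d \<in> polygon_darts ns"
  shows "cls (porig ns (\<sigma> d)) = cls (porig ns d)"
  using assms cls_pair cls_next by (auto simp: polygon_darts_def parallel_gluing_def porig_def)

lemma corner_eq_cls:
  assumes "(x, y) \<in> corner_eq ns \<sigma>"
  shows "cls x = cls y"
  using assms unfolding corner_eq_def
  by (induction rule: rtrancl_induct) (auto simp: cls_porig)

lemma dart_label_pair:
  assumes "d \<in> polygon_darts ns"
  shows "dart_label lab {d, \<sigma> d} = (lab (fst d), snd d)"
  using assms lab_pair
  by (auto simp: dart_label_def parallel_gluing_def polygon_darts_def)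

lemma immersion: "immersion (skeleton ns \<sigma>) bouquet (\<lambda>_. ()) (dart_label lab)"
proof -
  have flip: "dart_label lab (pflip ` D) = inv_letter (dart_label lab D)"
    if D: "D \<in> darts (skeleton ns \<sigma>)" for D
  proof -
    obtain d where d: "d \<in> polygon_darts ns" "D = {d, \<sigma> d}"
      using D unfolding skeleton_def dgraph.simps by blast
    then have "pflip ` D = {pflip d, \<sigma> (pflip d)}" "pflip d \<in> polygon_darts ns"
      by (auto simp: pflip_def parallel_gluing_def polygon_darts_def)
    then show ?thesis
      using d by (simp add: dart_label_pair) (simp add: pflip_def inv_letter_def)
  qed
  have inj: "D = D'"
    if D: "D \<in> darts (skeleton ns \<sigma>)" and D': "D' \<in> darts (skeleton ns \<sigma>)"
      and orig: "orig (skeleton ns \<sigma>) D = orig (skeleton ns \<sigma>) D'"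
      and label: "dart_label lab D = dart_label lab D'" for D D'
  proof -
    obtain d where d: "d \<in> polygon_darts ns" "D = {d, \<sigma> d}"
      using D unfolding skeleton_def dgraph.simps by blast
    obtain d' where d': "d' \<in> polygon_darts ns" "D' = {d', \<sigma> d'}"
      using D' unfolding skeleton_def dgraph.simps by blast
    have "porig ns d \<in> orig (skeleton ns \<sigma>) D"
      using d by (auto simp: skeleton_def corner_eq_def)
    then obtain e where "e \<in> D'" "(porig ns e, porig ns d) \<in> corner_eq ns \<sigma>"
      unfolding orig by (auto simp: skeleton_def)
    then have "e = d' \<or> e = \<sigma> d'" "cls (porig ns e) = cls (porig ns d)"
      using d'(2) corner_eq_cls by simp_all
    then have cls: "cls (porig ns d) = cls (porig ns d')"
      using cls_porig[OF d'(1)] by (elim disjE) simp_all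
    have "lab (fst d) = lab (fst d')" "snd d = snd d'"
      using label d d' by (simp_all add: dart_label_pair)
    \<comment> \<open>The common direction of \<open>d\<close> and \<open>d'\<close> decides which
      alternative of \<open>separated\<close> applies.\<close>
    then have "fst d' = fst d \<or> fst d' = \<pi> (fst d)"
      using cls d d' separated[of "fst d" "fst d'"]
      by (auto simp: polygon_darts_def porig_def split: if_splits)
    then have "d' = d \<or> d' = \<sigma> d"
      using \<open>snd d = snd d'\<close> by (auto simp: parallel_gluing_def prod_eq_iff)
    moreover have "\<sigma> (\<sigma> d) = d"
      using side_pairing d(1) by (simp add: side_pairing_def)
    ultimately show ?thesis
      using d(2) d'(2) by (elim disjE) (simp_all add: insert_commute)
  qed
  have "graph_map (skeleton ns \<sigma>) bouquet (\<lambda>_. ()) (dart_label lab)"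
    using flip by (auto simp: graph_map_def bouquet_def skeleton_def)
  then show ?thesis
    unfolding immersion_def by (intro conjI ballI inj_onI inj) simp_all
qed

lemma boundary_label:
  assumes "i < length ns"
  shows "map (dart_label lab) (boundary_loop ns \<sigma> i) =
    positive_word (map (\<lambda>j. lab (i, j)) [0..<ns ! i])"
  using assms
  by (auto simp: boundary_loop_def positive_word_def polygon_darts_def corners_def dart_label_pair)

section \<open>Counting edges and vertices\<close>

text \<open>All darts in an edge lie over one side and its partner, so an edge accounts for at most
  two sides; there are as many sides as corners.\<close>

lemma card_corners_le_edges: "card (corners ns) \<le> 2 * card (edges (skeleton ns \<sigma>))"
proof -
  define E where "E = edges (skeleton ns \<sigma>)"
  define edge where "edge d = {{d, \<sigma> d}, pflip ` {d, \<sigma> d}}" for d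
  have E: "E = edge ` polygon_darts ns"
    by (auto simp: E_def edges_def skeleton_def edge_def)
  have "finite E"
    by (simp add: E polygon_darts_def finite_corners)
  have sides: "fst ` \<Union> (edge d) = {fst d, \<pi> (fst d)}" for d
    by (auto simp: edge_def pflip_def parallel_gluing_def)
  have "corners ns \<subseteq> (\<Union>e\<in>E. fst ` \<Union> e)"
    by (force simp: E sides polygon_darts_def)
  moreover have "finite (fst ` \<Union> e)" if "e \<in> E" for e
    using that by (auto simp: E sides)
  ultimately have "card (corners ns) \<le> card (\<Union>e\<in>E. fst ` \<Union> e)"
    using \<open>finite E\<close> by (intro card_mono finite_UN_I)
  also have "\<dots> \<le> (\<Sum>e\<in>E. card (fst ` \<Union> e))"
    by (rule card_UN_le[OF \<open>finite E\<close>])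
  also have "\<dots> \<le> (\<Sum>e\<in>E. 2)"
    by (rule sum_mono) (auto simp: E sides card_insert_if)
  finally show ?thesis
    by (simp add: E_def)
qed

text \<open>Symmetry comes from \<open>\<sigma>\<close> being an involution. The purpose is that
  distinct vertices are disjoint sets of corners.\<close>

lemma equiv_corner_eq: "equiv UNIV (corner_eq ns \<sigma>)"
proof -
  define R where "R = {(porig ns d, porig ns (\<sigma> d)) | d. d \<in> polygon_darts ns}"
  have "sym R"
  proof (rule symI)
    fix x y
    assume "(x, y) \<in> R"
    then obtain d where d: "d \<in> polygon_darts ns" "x = porig ns d" "y = porig ns (\<sigma> d)"
      by (auto simp: R_def)
    then have "\<sigma> d \<in> polygon_darts ns" "\<sigma> (\<sigma> d) = d"
      using side_pairing by (auto simp: side_pairing_def)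
    then show "(y, x) \<in> R"
      unfolding R_def using d by (intro CollectI exI[of _ "\<sigma> d"]) simp
  qed
  then show ?thesis
    unfolding corner_eq_def R_def[symmetric]
    by (intro equivI refl_rtrancl sym_rtrancl trans_rtrancl) auto
qed

lemma corner_eq_pair:
  assumes "s \<in> corners ns"
  shows "(s, \<pi> s) \<in> corner_eq ns \<sigma>"
    and "(next_corner ns s, next_corner ns (\<pi> s)) \<in> corner_eq ns \<sigma>"
proof -
  have "(porig ns (s, b), porig ns (\<sigma> (s, b))) \<in> corner_eq ns \<sigma>" for b
    unfolding corner_eq_def using assms
    by (intro r_into_rtrancl CollectI exI[of _ "(s, b)"]) (simp add: polygon_darts_def)
  from this[of True] this[of False]
  show "(s, \<pi> s) \<in> corner_eq ns \<sigma>"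
    "(next_corner ns s, next_corner ns (\<pi> s)) \<in> corner_eq ns \<sigma>"
    by (simp_all add: porig_def parallel_gluing_def)
qed

lemma corner_eq_corners:
  assumes "(x, y) \<in> corner_eq ns \<sigma>" "x \<in> corners ns"
  shows "y \<in> corners ns"
  using assms unfolding corner_eq_def
  by (induction rule: rtrancl_induct)
    (auto simp: porig_def polygon_darts_def parallel_gluing_def pair_in next_corner_in_corners)

text \<open>The hypothesis on \<open>s\<close> says that the vertex at the end of the side \<open>s\<close> has at least three
  corners.\<close>

lemma card_verts_less:
  assumes s: "s \<in> corners ns" and branch: "next_corner ns (\<pi> s) \<noteq> \<pi> (next_corner ns s)"
  shows "2 * card (verts (skeleton ns \<sigma>)) < card (corners ns)"
proof -
  let ?r = "corner_eq ns \<sigma>"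
  define V where "V = verts (skeleton ns \<sigma>)"
  have V: "V = (\<lambda>c. ?r `` {c}) ` corners ns"
    by (auto simp: V_def skeleton_def quotient_def)
  have "finite V"
    by (simp add: V finite_corners)
  have sub: "?r `` {c} \<subseteq> corners ns" if "c \<in> corners ns" for c
    using that corner_eq_corners by blast
  have fin: "finite v" if "v \<in> V" for v
    using that finite_subset[OF sub finite_corners] unfolding V by blast
  have refl: "c \<in> ?r `` {c}" for c
    by (simp add: corner_eq_def)
  \<comment> \<open>A pair \<open>(i, j)\<close> names both a side and its first corner, so
    \<open>\<pi> c\<close> is a second corner glued to \<open>c\<close>.\<close>
  have two: "2 \<le> card v" if v: "v \<in> V" for v
  proof -
    obtain c where c: "c \<in> corners ns" "v = ?r `` {c}"
      using v V by blast
    then have "{c, \<pi> c} \<subseteq> v"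
      using corner_eq_pair(1) refl by auto
    then have "card {c, \<pi> c} \<le> card v"
      by (intro card_mono fin v)
    then show ?thesis
      using pair_neq[OF c(1)] by simp
  qed
  define t where "t = next_corner ns s"
  have t: "t \<in> corners ns"
    by (simp add: t_def next_corner_in_corners s)
  then have tV: "?r `` {t} \<in> V"
    by (simp add: V)
  \<comment> \<open>The corner \<open>t\<close> is glued to \<open>\<pi> t\<close> along the side
    leaving \<open>t\<close>, and to the end of \<open>\<pi> s\<close> along the side
    \<open>s\<close> arriving there.\<close>
  have "{t, \<pi> t, next_corner ns (\<pi> s)} \<subseteq> ?r `` {t}"
    using corner_eq_pair(1)[OF t] corner_eq_pair(2)[OF s] refl by (auto simp: t_def)
  then have "card {t, \<pi> t, next_corner ns (\<pi> s)} \<le> card (?r `` {t})"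
    by (intro card_mono fin tV)
  moreover have "next_corner ns (\<pi> s) \<noteq> t"
    unfolding t_def
    using inj_on_next_corner[THEN inj_on_contraD, OF pair_neq[OF s] pair_in[OF s] s] .
  ultimately have three: "2 < card (?r `` {t})"
    using branch pair_neq[OF t] unfolding t_def[symmetric] by simp
  \<comment> \<open>Vertices partition the corners, so their sizes add up to the number of
    corners.\<close>
  have "2 * card V = (\<Sum>v\<in>V. 2)"
    by simp
  also have "\<dots> < (\<Sum>v\<in>V. card v)"
    using two three tV \<open>finite V\<close> by (intro sum_strict_mono_ex1) auto
  also have "\<dots> = card (\<Union> V)"
  proof (rule card_Union_disjoint[symmetric])
    have "V \<subseteq> UNIV // ?r"
      unfolding V by (intro image_subsetI quotientI) simp
    then show "pairwise disjnt V"
      unfolding pairwise_def disjnt_def using quotient_disj[OF equiv_corner_eq] by blast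
  qed (use fin in auto)
  also have "\<Union> V = corners ns"
    using sub refl by (auto simp: V)
  finally show ?thesis
    by (simp add: V_def)
qed

lemma polygonal:
  assumes nonempty: "\<And>n. n \<in> set ns \<Longrightarrow> n \<ge> 1"
    and boundary: "\<And>i. i < length ns \<Longrightarrow>
      \<exists>k>0. map (\<lambda>j. lab (i, j)) [0..<ns ! i] = concat (replicate k xs)"
    and branch: "\<exists>s\<in>corners ns. next_corner ns (\<pi> s) \<noteq> \<pi> (next_corner ns s)"
  shows "polygonal (positive_word xs)"
proof -
  have "\<exists>k. k \<noteq> 0 \<and> reads (map (dart_label lab) (boundary_loop ns \<sigma> i))
      (word_power (positive_word xs) k)" if i: "i < length ns" for i
  proof -
    let ?u = "map (\<lambda>j. lab (i, j)) [0..<ns ! i]"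
    obtain k where k: "k > 0" "?u = concat (replicate k xs)"
      using boundary[OF i] by blast
    have "?u \<noteq> []"
      using nonempty[of "ns ! i"] i by simp
    then have "reads (positive_word ?u) (word_power (positive_word xs) (int k))"
      unfolding word_power_positive k(2)[symmetric] by (rule reads_positive)
    then show ?thesis
      using k(1) by (intro exI[of _ "int k"]) (simp add: boundary_label[OF i])
  qed
  then have "polygonal_surface (positive_word xs) ns \<sigma> (\<lambda>_. ()) (dart_label lab)"
    using nonempty side_pairing immersion by (simp add: polygonal_surface_def)
  \<comment> \<open>With V vertices, E edges and n corners, 2V < n <= 2E gives V - E < 0.\<close>
  moreover have "euler_char ns \<sigma> < int (length ns)"
    using branch card_verts_less card_corners_le_edges
    by (fastforce simp: euler_char_def)
  ultimately show ?thesis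
    unfolding polygonal_def using cyclically_reduced_positive by blast
qed

end


section \<open>One-disk certificates\<close>

text \<open>For one polygon reading \<open>u\<close>, \<open>ps\<close> lists the partners of the
  sides and \<open>cs\<close> the \<open>cls\<close> values of the corners. Ranging over
  \<open>set [0..<n]\<close> makes the predicate executable. The last clause yields the vertex of
  degree at least three.\<close>

definition disk_certificate :: "'a list \<Rightarrow> nat list \<Rightarrow> nat list \<Rightarrow> bool" where
  "disk_certificate u ps cs \<longleftrightarrow>
     (let n = length u in
      (\<forall>j\<in>set [0..<n].
         ps ! j < n \<and> ps ! (ps ! j) = j \<and> ps ! j \<noteq> j \<and> u ! (ps ! j) = u ! j \<and>
         cs ! (ps ! j) = cs ! j \<and> cs ! (Suc (ps ! j) mod n) = cs ! (Suc j mod n) \<and>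
         (\<forall>k\<in>set [0..<n]. u ! j = u ! k \<longrightarrow>
            cs ! j = cs ! k \<or> cs ! (Suc j mod n) = cs ! (Suc k mod n) \<longrightarrow>
            k = j \<or> k = ps ! j)) \<and>
      (\<exists>j\<in>set [0..<n]. Suc (ps ! j) mod n \<noteq> ps ! (Suc j mod n)))"

lemma polygonal_disk_certificate:
  assumes cert: "disk_certificate (concat (replicate k xs)) ps cs" and k: "k > 0"
  shows "polygonal (positive_word xs)"
proof -
  define u where "u = concat (replicate k xs)"
  define n where "n = length u"
  have corners: "corners [n] = {0} \<times> {..<n}"
    by (auto simp: corners_def)
  note cert' = cert[folded u_def, unfolded disk_certificate_def Let_def, folded n_def, simplified]
  have sep: "k = j \<or> k = ps ! j"
    if "j < n" "k < n" "u ! j = u ! k"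
      "cs ! j = cs ! k \<or> cs ! (Suc j mod n) = cs ! (Suc k mod n)" for j k
    using cert' that by (meson atLeastLessThan_iff le0)
  interpret labelled_pairing "[n]" "\<lambda>s. (0, ps ! snd s)" "\<lambda>s. u ! snd s" "\<lambda>s. cs ! snd s"
  proof
    fix s t :: side
    assume s: "s \<in> corners [n]" and t: "t \<in> corners [n]" and "u ! snd s = u ! snd t"
      "cs ! snd s = cs ! snd t \<or> cs ! snd (next_corner [n] s) = cs ! snd (next_corner [n] t)"
    then show "t = s \<or> t = (0, ps ! snd s)"
      using sep[of "snd s" "snd t"] by (auto simp: corners next_corner_def)
  qed (use cert' in \<open>auto simp: corners next_corner_def\<close>)
  show ?thesis
  proof (rule polygonal)
    fix m
    assume "m \<in> set [n]"
    \<comment> \<open>The existential clause of the certificate provides an index below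
      \<open>n\<close>.\<close>
    then show "m \<ge> 1"
      using cert' by auto
  next
    fix i
    assume "i < length [n]"
    then show "\<exists>k>0. map (\<lambda>j. u ! snd (i, j)) [0..<[n] ! i] = concat (replicate k xs)"
      using k by (intro exI[of _ k]) (simp add: n_def map_nth u_def[symmetric])
  next
    show "\<exists>s\<in>corners [n]. next_corner [n] (0, ps ! snd s) \<noteq> (0, ps ! snd (next_corner [n] s))"
      using cert' by (auto simp: corners next_corner_def)
  qed
qed


theorem proposition32:
  shows "polygonal (positive_word [b3, b3, a3, a3, c3, c3, a3, b3, c3]) \<and>
    polygonal (positive_word
      [a4, a4, b4, b4, a4, c4, b4, c4, c4, a4, d4, b4, d4, c4, d4, d4])"
proof
  \<comment> \<open>Each letter occurs three times in the word, so one copy admits no pairing of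
    equal labels; the square does. Each corner is labelled by the least corner of its vertex, giving
    four vertices against nine edges.\<close>
  have "disk_certificate (concat (replicate 2 [b3, b3, a3, a3, c3, c3, a3, b3, c3]))
    [7, 16, 3, 2, 17, 13, 12, 0, 14, 10, 9, 15, 6, 5, 8, 11, 1, 4]
    [0, 1, 2, 2, 2, 0, 1, 0, 1, 9, 9, 9, 1, 0, 1, 9, 1, 2]"
    by code_simp
  then show "polygonal (positive_word [b3, b3, a3, a3, c3, c3, a3, b3, c3])"
    by (rule polygonal_disk_certificate) simp
next
  \<comment> \<open>Here each letter occurs four times and one copy suffices, with four vertices
    against eight edges, labelled in the same way.\<close>
  have "disk_certificate
    (concat (replicate 1 [a4, a4, b4, b4, a4, c4, b4, c4, c4, a4, d4, b4, d4, c4, d4, d4]))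
    [1, 0, 11, 6, 9, 13, 3, 8, 7, 4, 15, 2, 14, 5, 12, 10]
    [0, 0, 0, 3, 4, 5, 3, 4, 4, 4, 5, 0, 3, 5, 3, 5]"
    by code_simp
  then show "polygonal (positive_word
      [a4, a4, b4, b4, a4, c4, b4, c4, c4, a4, d4, b4, d4, c4, d4, d4])"
    by (rule polygonal_disk_certificate) simp
qed

end
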